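(* For all integers $n,k$ with $n-1\geq 2k\geq 2$, $$\sum_{m=1}^{\lfloor n/2\rfloor+1}(-1)^{m}\binom{n}{2m-1}\int_0^\infty [\pi I_0(t)]^{n-2m+1}[K_0(t)]^{n+2m-1}\,t^{n-2k-1}\,dt=0.$$
   Context: $I_0$ and $K_0$ are the modified Bessel functions of order zero, given for $t>0$ by $I_0(t)=\frac1\pi\int_0^\pi e^{t\cos\theta}\,d\theta$ and $K_0(t)=\int_0^\infty e^{-t\cosh u}\,du$. $\lfloor x\rfloor$ is the greatest integer less than or equal to $x$. Binomial coefficients are $\binom{n}{j}=\frac{n!}{j!(n-j)!}$ for $0\le j\le n$ and $\binom{n}{j}=0$ for $j>n$, so any summand with $2m-1>n$ is zero. *)

theory Defs
  imports "HOL-Analysis.Analysis"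
begin

text \<open>
  Modified Bessel functions of order zero, by their integral representations; the
  values are only meaningful for \<open>t > 0\<close>, where the integrals converge.
\<close>

definition bessel_I0 :: "real \<Rightarrow> real" where
  "bessel_I0 t = (1 / pi) * (LBINT \<theta>:{0..pi}. exp (t * cos \<theta>))"

definition bessel_K0 :: "real \<Rightarrow> real" where
  "bessel_K0 t = (LBINT u:{0<..}. exp (- t * cosh u))"

end

theory Submission
  imports Defs "HOL-Complex_Analysis.Complex_Analysis"
begin

text \<open>
  The sum is, up to sign, the imaginary part of the integral over \<open>t > 0\<close> of
  \<open>F(t) = t\<^sup>p (K\<^sub>0 (\<pi> I\<^sub>0 + i K\<^sub>0))\<^sup>n\<close> with \<open>p = n - 2 k - 1\<close>: expand the power binomially. Since
  \<open>K\<^sub>0(- t) = K\<^sub>0(t) - i \<pi> I\<^sub>0(t)\<close> when \<open>- t\<close> is approached from the upper half plane, \<open>F\<close> is the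
  boundary value of \<open>z\<^sup>p (i K\<^sub>0(z) K\<^sub>0(- z))\<^sup>n\<close>, which is holomorphic for \<open>Im z < 0\<close>. There it is
  \<open>O(\<bar>z\<bar> powr - 2)\<close> and \<open>O(\<bar>z\<bar> powr - 1/2)\<close>, so its integral over the whole real line vanishes by
  Cauchy's theorem. Because \<open>n + p\<close> is odd, \<open>F(- cnj z) = - cnj (F z)\<close>, so the integral over the
  whole line is \<open>2 i\<close> times that of \<open>Im F\<close> over \<open>t > 0\<close>.
\<close>

section \<open>A singular majorant and its scaling\<close>

text \<open>For nonnegative functions gauge integrability is absolute integrability, so known
  \<open>has_integral\<close> facts about powers, exponentials and the Gamma integral carry over to
  \<open>lborel\<close>.\<close>

lemma integrable_lborel_indicator_nonneg:
  fixes f :: "real \<Rightarrow> real"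
  assumes "f integrable_on S" "\<And>x. x \<in> S \<Longrightarrow> 0 \<le> f x"
    and [measurable]: "f \<in> borel_measurable borel" "S \<in> sets borel"
  shows "integrable lborel (\<lambda>x. indicator S x * f x)"
proof -
  have "set_integrable lebesgue S f"
    using assms by (intro nonnegative_absolutely_integrable_1)
  thus ?thesis
    unfolding set_integrable_def by (subst (asm) integrable_completion) auto
qed

text \<open>For \<open>\<bar>z\<bar> = r\<close> this majorises \<open>\<bar>exp (- x) / sqrt (x (x + z))\<bar>\<close>, by \<open>exp (- x) \<le> x powr (- d)\<close> and
  \<open>\<bar>x + z\<bar> \<ge> \<bar>x - r\<bar>\<close>. The value \<open>0\<close> at \<open>x = r\<close> is junk, so that the bound holds only almost everywhere.\<close>

definition gap_kernel :: "real \<Rightarrow> real \<Rightarrow> real \<Rightarrow> real" where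
  "gap_kernel d r x = indicator {0<..} x * (x powr (- 1/2 - d) / sqrt \<bar>x - r\<bar>)"

lemma gap_kernel_nonneg: "gap_kernel d r x \<ge> 0"
  by (simp add: gap_kernel_def indicator_def)

lemma gap_kernel_measurable [measurable]: "gap_kernel d r \<in> borel_measurable borel"
  unfolding gap_kernel_def by measurable

text \<open>The exponents are -1/2 - d > -1 at 0 and -1/2 at 1, and the tail decays like x powr (- 1
  - d); the range of \<open>d\<close> makes all three integrable.\<close>

lemma integrable_gap_kernel_1:
  assumes "0 < d" "d < 1/2"
  shows "integrable lborel (gap_kernel d 1)"
proof -
  define q where "q = (\<lambda>a x::real. indicator {0<..1} x * x powr a :: real)"
  define T where "T = (\<lambda>x::real. indicator {1..} x * x powr (- 1 - d) :: real)"
  have q: "integrable lborel (q a)" if "a > -1" for a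
    unfolding q_def using that
    by (intro integrable_lborel_indicator_nonneg integrable_on_powr_from_0') auto
  have T: "integrable lborel T"
    unfolding T_def using assms has_integral_powr_to_inf[of "- 1 - d" 1]
    by (intro integrable_lborel_indicator_nonneg) (auto simp: integrable_on_def)
  have q1: "integrable lborel (\<lambda>x. q (-1/2) (x - 1))"
    using lborel_integrable_real_affine[OF q, of "-1/2" 1 "-1"] by simp
  have q2: "integrable lborel (\<lambda>x. q (-1/2) (1 - x))"
    using lborel_integrable_real_affine[OF q, of "-1/2" "-1" 1] by simp
  \<comment> \<open>The singularity at 0, the two sides of the one at 1 and the tail are majorised
    separately. The factors come from 1 / sqrt |x - 1| <= sqrt 2 for x <= 1/2, from x powr (- 1/2 -
    d) <= 2 for x > 1/2, and from |x - 1| >= x / 2 for x >= 2.\<close>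
  define h where "h = (\<lambda>x. sqrt 2 * q (- 1/2 - d) x + 2 * (q (-1/2) (x - 1) + q (-1/2) (1 - x)) + sqrt 2 * T x)"
  have h: "integrable lborel h"
    unfolding h_def using q[of "-1/2 - d"] q1 q2 T assms by (intro Bochner_Integration.integrable_add integrable_mult_right) auto
  have q0: "0 \<le> q a x" "0 \<le> sqrt 2 * q a x" "0 \<le> sqrt 2 * T x" for a x
    by (auto simp: q_def T_def)
  have "gap_kernel d 1 x \<le> h x" for x
  proof (cases "x > 0")
    case True
    note nonneg = q0(1)[of "-1/2" "x - 1"] q0(1)[of "-1/2" "1 - x"] q0(2)[of "-1/2 - d" x] q0(3)[of x]
    have hI: "y \<le> h x" if "y \<le> sqrt 2 * q (-1/2 - d) x \<or> y \<le> 2 * q (-1/2) (x - 1) \<or>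
        y \<le> 2 * q (-1/2) (1 - x) \<or> y \<le> sqrt 2 * T x" for y
    proof -
      have "y \<le> A + 2 * (B + C) + D" if "y \<le> A \<or> y \<le> 2 * B \<or> y \<le> 2 * C \<or> y \<le> D"
        "0 \<le> A" "0 \<le> B" "0 \<le> C" "0 \<le> D" for A B C D
        using that by auto
      thus ?thesis using that nonneg unfolding h_def by blast
    qed
    have eq: "gap_kernel d 1 x = x powr (-1/2 - d) * (1 / sqrt \<bar>x - 1\<bar>)"
      using True by (simp add: gap_kernel_def)
    consider "x \<le> 1/2" | "1/2 < x" "x < 1" | "x = 1" | "1 < x" "x \<le> 2" | "2 < x"
      by linarith
    thus ?thesis
    proof cases
      case 1
      have "1 / sqrt \<bar>x - 1\<bar> \<le> 1 / sqrt (1/2)"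
        using 1 by (intro divide_left_mono) auto
      also have "\<dots> = sqrt 2" by (simp add: real_sqrt_divide)
      finally have "x powr (-1/2 - d) * (1 / sqrt \<bar>x - 1\<bar>) \<le> x powr (-1/2 - d) * sqrt 2"
        by (intro mult_left_mono) auto
      also have "\<dots> = sqrt 2 * q (-1/2 - d) x"
        using 1 True by (simp add: q_def)
      finally show ?thesis
        unfolding eq by (intro hI) blast
    next
      case 2
      have "x powr (-1/2 - d) \<le> (1/2) powr (-1/2 - d)"
        using 2 assms by (intro powr_mono2') auto
      also have "\<dots> \<le> (1/2) powr (-1)"
        using assms by (intro powr_mono') auto
      finally have "x powr (-1/2 - d) * (1 / sqrt \<bar>x - 1\<bar>) \<le> 2 * (1 / sqrt \<bar>x - 1\<bar>)"
        by (intro mult_right_mono) (auto simp: powr_minus)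
      also have "2 * (1 / sqrt \<bar>x - 1\<bar>) = 2 * q (-1/2) (1 - x)"
        using 2 by (simp add: q_def powr_minus powr_half_sqrt inverse_eq_divide)
      finally show ?thesis
        unfolding eq by (intro hI) blast
    next
      case 3
      thus ?thesis using nonneg unfolding eq h_def by simp
    next
      case 4
      have "x powr (-1/2 - d) \<le> 1 powr (-1/2 - d)"
        using 4 assms by (intro powr_mono2') auto
      hence "x powr (-1/2 - d) * (1 / sqrt \<bar>x - 1\<bar>) \<le> 2 * (1 / sqrt \<bar>x - 1\<bar>)"
        by (intro mult_right_mono) auto
      also have "2 * (1 / sqrt \<bar>x - 1\<bar>) = 2 * q (-1/2) (x - 1)"
        using 4 by (simp add: q_def powr_minus powr_half_sqrt inverse_eq_divide)
      finally show ?thesis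
        unfolding eq by (intro hI) blast
    next
      case 5
      have "1 / sqrt \<bar>x - 1\<bar> \<le> 1 / sqrt (x / 2)"
        using 5 by (intro divide_left_mono) auto
      also have "\<dots> = sqrt 2 * x powr (-1/2)"
        using 5 by (simp add: real_sqrt_divide powr_minus powr_half_sqrt inverse_eq_divide)
      finally have "x powr (-1/2 - d) * (1 / sqrt \<bar>x - 1\<bar>) \<le> x powr (-1/2 - d) * (sqrt 2 * x powr (-1/2))"
        by (intro mult_left_mono) auto
      also have "\<dots> = sqrt 2 * x powr (-1 - d)"
        by (simp add: powr_add[symmetric])
      also have "\<dots> = sqrt 2 * T x" using 5 by (simp add: T_def)
      finally show ?thesis
        unfolding eq by (intro hI) blast
    qed
  next
    case False
    thus ?thesis using q0 by (simp add: gap_kernel_def h_def)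
  qed
  hence "norm (gap_kernel d 1 x) \<le> norm (h x)" for x
    using gap_kernel_nonneg[of d 1 x] by (smt (verit) real_norm_def)
  thus ?thesis
    by (intro Bochner_Integration.integrable_bound[OF h]) auto
qed

text \<open>The kernel is homogeneous of degree - 1 - d in (x, r) jointly. With the Jacobian
  \<open>r\<close>, this turns its integral into r powr (- d) times a constant.\<close>

lemma gap_kernel_scale:
  assumes "r > 0"
  shows "gap_kernel d r (r * s) = r powr (- 1 - d) * gap_kernel d 1 s"
proof (cases "s > 0")
  case True
  have "sqrt \<bar>r * s - r\<bar> = sqrt r * sqrt \<bar>s - 1\<bar>"
    using assms by (simp flip: real_sqrt_mult add: abs_mult_pos' algebra_simps)
  moreover have "r powr (- 1/2 - d) / sqrt r = r powr (- 1 - d)"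
    using assms by (simp add: powr_half_sqrt[symmetric] powr_diff[symmetric] )
  ultimately show ?thesis using True assms
    by (simp add: gap_kernel_def powr_mult divide_simps zero_less_mult_iff)
next
  case False
  thus ?thesis using assms by (simp add: gap_kernel_def zero_less_mult_iff)
qed

lemma gap_kernel_integral:
  assumes "0 < d" "d < 1/2" "r > 0"
  shows "integrable lborel (gap_kernel d r)"
    and "(\<integral>x. gap_kernel d r x \<partial>lborel) = r powr (- d) * (\<integral>x. gap_kernel d 1 x \<partial>lborel)"
proof -
  have "integrable lborel (\<lambda>s. gap_kernel d r (0 + r * s))"
    using integrable_gap_kernel_1[OF assms(1,2)] assms(3)
    by (simp add: gap_kernel_scale)
  thus "integrable lborel (gap_kernel d r)"
    using assms(3) by (subst (asm) lborel_integrable_real_affine_iff) auto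
  have "(\<integral>x. gap_kernel d r x \<partial>lborel) = \<bar>r\<bar> *\<^sub>R (\<integral>s. gap_kernel d r (0 + r * s) \<partial>lborel)"
    using assms by (intro lborel_integral_real_affine) auto
  also have "\<dots> = (r * r powr (- 1 - d)) * (\<integral>x. gap_kernel d 1 x \<partial>lborel)"
    using assms by (simp add: gap_kernel_scale)
  also have "r * r powr (- 1 - d) = r powr (- d)"
    using assms by (simp add: powr_mult_base)
  finally show "(\<integral>x. gap_kernel d r x \<partial>lborel) = r powr (- d) * (\<integral>x. gap_kernel d 1 x \<partial>lborel)" .
qed

section \<open>An algebraic integral representation of K_0\<close>

text \<open>The square root of x (x + z) is split so that \<open>csqrt\<close> acts on x + z alone;
  for non-real \<open>z\<close> this argument never meets the cut.\<close>

definition laplace_kernel :: "complex \<Rightarrow> real \<Rightarrow> complex" where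
  "laplace_kernel z x = indicator {0<..} x *\<^sub>R (of_real (exp (- x) / sqrt x) / csqrt (of_real x + z))"

text \<open>\<open>laplace_bessel z\<close> is \<open>exp (z / 2) K\<^sub>0 (z / 2)\<close>; on the negative axis, where \<open>csqrt\<close> takes its values
  from the upper side of the cut, it is the boundary value from the upper half plane.\<close>

definition laplace_bessel :: "complex \<Rightarrow> complex" where
  "laplace_bessel z = (\<integral>x. laplace_kernel z x \<partial>lborel)"

lemma csqrt_measurable [measurable]: "csqrt \<in> borel_measurable borel"
proof -
  have "csqrt = (\<lambda>z. if z = 0 then 0 else exp (Ln z / 2))"
    by (auto simp: csqrt_exp_Ln)
  also have "\<dots> \<in> borel_measurable borel" by measurable
  finally show ?thesis .
qed

lemma laplace_kernel_measurable [measurable]: "laplace_kernel z \<in> borel_measurable borel"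
  unfolding laplace_kernel_def by measurable

lemma norm_csqrt_eq: "norm (csqrt z) = sqrt (norm z)"
  by (metis norm_power power2_csqrt norm_ge_zero real_sqrt_unique)

text \<open>The radius \<open>r\<close> is left free: r = |z| gives the power bound on
  \<open>laplace_bessel\<close>, and r = |Re z| gives a majorant common to all imaginary
  parts.\<close>

lemma norm_laplace_kernel_le:
  assumes "\<bar>x - r\<bar> \<le> norm (of_real x + z)" "x \<noteq> r" "0 \<le> d" "d \<le> 1"
  shows "norm (laplace_kernel z x) \<le> gap_kernel d r x"
proof (cases "x > 0")
  case True
  have "x powr d \<le> exp x"
  proof (cases "x \<le> 1")
    case True
    have "x powr d \<le> 1" using True \<open>x > 0\<close> assms by (intro powr_le1) auto
    also have "1 \<le> exp x" using \<open>x > 0\<close> by simp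
    finally show ?thesis .
  next
    case False
    hence "x powr d \<le> x powr 1" using assms by (intro powr_mono) auto
    also have "\<dots> \<le> exp x" using exp_ge_add_one_self[of x] \<open>x > 0\<close> by (simp only: powr_one)
    finally show ?thesis .
  qed
  hence "exp (- x) \<le> x powr (- d)"
    using True by (simp add: exp_minus powr_minus le_imp_inverse_le)
  hence "exp (- x) / sqrt x \<le> x powr (- d) / sqrt x"
    using True by (intro divide_right_mono) auto
  also have "\<dots> = x powr (- 1/2 - d)"
    using True by (simp add: powr_half_sqrt[symmetric] powr_diff[symmetric] minus_diff_commute)
  finally have "exp (- x) / sqrt x \<le> x powr (- 1/2 - d)" .
  moreover have "norm (laplace_kernel z x) = (exp (- x) / sqrt x) / sqrt (norm (of_real x + z))"
    using True by (simp add: laplace_kernel_def norm_divide norm_csqrt_eq norm_mult)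
  moreover have "gap_kernel d r x = x powr (- 1/2 - d) / sqrt \<bar>x - r\<bar>"
    using True by (simp add: gap_kernel_def)
  moreover have "exp (- x) / sqrt x / sqrt (norm (of_real x + z)) \<le> x powr (- 1/2 - d) / sqrt \<bar>x - r\<bar>"
    using assms calculation(1) by (intro frac_le) auto
  ultimately show ?thesis
    by simp
next
  case False
  thus ?thesis by (simp add: laplace_kernel_def gap_kernel_def)
qed

lemma abs_diff_norm_le:
  fixes z :: complex
  assumes "x \<ge> 0"
  shows "\<bar>x - norm z\<bar> \<le> norm (of_real x + z)"
  using norm_triangle_ineq3[of "of_real x" "- z"] assms by simp

lemma AE_norm_laplace_kernel_le:
  assumes "0 \<le> d" "d \<le> 1"
  shows "AE x in lborel. norm (laplace_kernel z x) \<le> gap_kernel d (norm z) x"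
  using AE_lborel_singleton[of "norm z"]
proof eventually_elim
  case (elim x)
  show ?case
  proof (cases "x > 0")
    case True
    with elim assms abs_diff_norm_le[of x z] show ?thesis by (intro norm_laplace_kernel_le) auto
  next
    case False
    thus ?thesis by (simp add: laplace_kernel_def gap_kernel_def)
  qed
qed

lemma integrable_laplace_kernel:
  assumes "z \<noteq> 0"
  shows "integrable lborel (laplace_kernel z)"
proof (rule Bochner_Integration.integrable_bound)
  show "integrable lborel (gap_kernel (1/4) (norm z))"
    using assms by (intro gap_kernel_integral) auto
  show "AE x in lborel. norm (laplace_kernel z x) \<le> norm (gap_kernel (1/4) (norm z) x)"
    using AE_norm_laplace_kernel_le[of "1/4" z] gap_kernel_nonneg by auto
qed auto

text \<open>The free exponent lets one estimate serve both ends: \<open>d\<close> near 0 gives a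
  weak singularity at 0, \<open>d\<close> near 1/2 gives decay at infinity.\<close>

lemma norm_laplace_bessel_le:
  assumes "z \<noteq> 0" "0 < d" "d < 1/2"
  shows "norm (laplace_bessel z) \<le> norm z powr (- d) * (\<integral>x. gap_kernel d 1 x \<partial>lborel)"
proof -
  have "norm (laplace_bessel z) \<le> (\<integral>x. norm (laplace_kernel z x) \<partial>lborel)"
    unfolding laplace_bessel_def by (rule integral_norm_bound)
  also have "\<dots> \<le> (\<integral>x. gap_kernel d (norm z) x \<partial>lborel)"
    using assms
    by (intro integral_mono_AE integrable_norm integrable_laplace_kernel gap_kernel_integral
              AE_norm_laplace_kernel_le) auto
  also have "\<dots> = norm z powr (- d) * (\<integral>x. gap_kernel d 1 x \<partial>lborel)"
    using assms by (intro gap_kernel_integral) auto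
  finally show ?thesis .
qed

text \<open>\<open>csqrt\<close> commutes with conjugation off its cut, and x + z stays off the cut
  when \<open>z\<close> is not real.\<close>

lemma laplace_bessel_cnj:
  assumes "Im z \<noteq> 0"
  shows "laplace_bessel (cnj z) = cnj (laplace_bessel z)"
proof -
  have "laplace_kernel (cnj z) x = cnj (laplace_kernel z x)" for x
  proof -
    have "of_real x + z \<notin> \<real>\<^sub>\<le>\<^sub>0" using assms by (auto simp: complex_nonpos_Reals_iff)
    thus ?thesis by (simp add: laplace_kernel_def cnj_csqrt del: csqrt.simps)
  qed
  thus ?thesis by (simp add: laplace_bessel_def)
qed

text \<open>\<open>csqrt\<close> jumps across the negative axis, but restricted to the closed upper
  half plane it is continuous: there its explicit formula involves no choice of sign.\<close>

lemma tendsto_csqrt_upper: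
  assumes "(f \<longlongrightarrow> l) F" "eventually (\<lambda>x. Im (f x) \<ge> 0) F" "Im l \<ge> 0"
  shows "((\<lambda>x. csqrt (f x)) \<longlongrightarrow> csqrt l) F"
proof -
  have eq: "csqrt w = Complex (sqrt ((norm w + Re w) / 2)) (sqrt ((norm w - Re w) / 2))" if "Im w \<ge> 0" for w
    using that by (auto simp: complex_eq_iff)
  have "((\<lambda>x. Complex (sqrt ((norm (f x) + Re (f x)) / 2)) (sqrt ((norm (f x) - Re (f x)) / 2))) \<longlongrightarrow> csqrt l) F"
    unfolding eq[OF assms(3)] by (intro tendsto_intros assms) auto
  moreover have "eventually (\<lambda>x. csqrt (f x) = 
      Complex (sqrt ((norm (f x) + Re (f x)) / 2)) (sqrt ((norm (f x) - Re (f x)) / 2))) F"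
    using assms(2) by eventually_elim (rule eq)
  ultimately show ?thesis
    by (simp only: tendsto_cong)
qed

text \<open>Dominated convergence. Since |x + r + i v| >= |x + r| >= |x - |r||, the majorant with
  radius |r| does not depend on the height v.\<close>

lemma laplace_bessel_boundary:
  assumes "r \<noteq> 0" "y \<longlonglongrightarrow> 0" "\<And>n. y n \<ge> 0"
  shows "(\<lambda>n. laplace_bessel (Complex r (y n))) \<longlonglongrightarrow> laplace_bessel (of_real r)"
  unfolding laplace_bessel_def
proof (rule integral_dominated_convergence)
  show "integrable lborel (gap_kernel (1/4) \<bar>r\<bar>)"
    using assms by (intro gap_kernel_integral) auto
  have ge: "\<bar>x - \<bar>r\<bar>\<bar> \<le> norm (of_real x + Complex r v)" if "x > 0" for x v
    using abs_Re_le_cmod[of "of_real x + Complex r v"] that by auto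
  show "AE x in lborel. norm (laplace_kernel (Complex r (y n)) x) \<le> gap_kernel (1/4) \<bar>r\<bar> x" for n
    using AE_lborel_singleton[of "\<bar>r\<bar>"]
  proof eventually_elim
    case (elim x)
    show ?case
    proof (cases "x > 0")
      case True
      with elim ge[of x] show ?thesis by (intro norm_laplace_kernel_le) auto
    next
      case False
      thus ?thesis by (simp add: laplace_kernel_def gap_kernel_def)
    qed
  qed
  show "AE x in lborel. (\<lambda>n. laplace_kernel (Complex r (y n)) x) \<longlonglongrightarrow> laplace_kernel (of_real r) x"
    \<comment> \<open>At x = - r the denominator of the limit kernel vanishes.\<close>
    using AE_lborel_singleton[of "- r"]
  proof eventually_elim
    case (elim x)
    have "(\<lambda>n. of_real x + Complex r (y n)) \<longlonglongrightarrow> of_real x + Complex r 0"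
      by (intro tendsto_intros assms)
    also have "Complex r 0 = of_real r" by (simp add: complex_of_real_def)
    finally have "(\<lambda>n. csqrt (of_real x + Complex r (y n))) \<longlonglongrightarrow> csqrt (of_real x + of_real r)"
      using assms by (intro tendsto_csqrt_upper) auto
    moreover have "csqrt (of_real x + of_real r) \<noteq> 0"
      using elim by (simp flip: of_real_add del: csqrt.simps)
    ultimately show ?case
      unfolding laplace_kernel_def by (intro tendsto_intros)
  qed
qed auto

section \<open>Holomorphy off the real axis\<close>

definition laplace_weight :: "real \<Rightarrow> real" where
  "laplace_weight x = indicator {0<..} x * (exp (- x) / sqrt x)"

lemma integrable_laplace_weight: "integrable lborel laplace_weight"
proof -
  have "integrable lborel (\<lambda>x::real. indicator {0..} x * (x powr (- 1/2) / exp x))"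
    using Gamma_integral_real[of "1/2"]
    by (intro integrable_lborel_indicator_nonneg) (auto simp: integrable_on_def)
  also have "(\<lambda>x. indicator {0..} x * (x powr (- 1/2) / exp x)) = laplace_weight"
    by (auto simp: fun_eq_iff laplace_weight_def indicator_def powr_minus powr_half_sqrt exp_minus field_simps)
  finally show ?thesis .
qed

text \<open>On the cut-off interval the integrand is smooth in both variables; the discarded tails tend
  to \<open>0\<close> uniformly as long as the imaginary part of \<open>z\<close> stays away from \<open>0\<close>.\<close>

lemma laplace_bessel_holomorphic:
  assumes "open U" "convex U" and U: "\<And>z. z \<in> U \<Longrightarrow> Im z \<noteq> 0"
  shows "laplace_bessel holomorphic_on U"
proof -
  \<comment> \<open>These compact intervals exhaust x > 0 and also keep away from 0, where 1 / sqrt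
    x is singular.\<close>
  define I where "I = (\<lambda>n. {1 / real (Suc n)..real (Suc n)})"
  define g where "g = (\<lambda>z x. of_real (exp (- x) / sqrt x) / csqrt (of_real x + z) :: complex)"
  define \<epsilon> where "\<epsilon> = (\<lambda>n. \<integral>x. indicator (- I n) x * laplace_weight x \<partial>lborel)"
  have ipos: "x > 0" if "x \<in> I n" for x n
    using that by (auto simp: I_def intro: less_le_trans[rotated])
  have np: "of_real x + z \<notin> \<real>\<^sub>\<le>\<^sub>0" if "z \<in> U" for x z
    using U[OF that] by (auto simp: complex_nonpos_Reals_iff)
  have [measurable]: "I n \<in> sets borel" for n by (simp add: I_def)
  have [measurable]: "laplace_weight \<in> borel_measurable borel"
    using borel_measurable_integrable[OF integrable_laplace_weight] by simp
  have nz: "csqrt (of_real x + z) \<noteq> 0" if "z \<in> U" for x z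
    using np[OF that, of x] by (metis csqrt_eq_0 complex_nonpos_Reals_iff zero_complex.sel order.refl)
  have cont: "continuous_on (I n) (g z)" if "z \<in> U" for z n
  proof -
    have "continuous_on (I n) (\<lambda>x. csqrt (of_real x + z))"
      using np[OF that] by (intro continuous_on_compose2[OF continuous_on_csqrt] continuous_intros) auto
    moreover have "\<forall>x\<in>I n. sqrt x \<noteq> 0" using ipos[of _ n] by force
    ultimately show ?thesis
      unfolding g_def using nz[OF that] by (intro continuous_intros) auto
  qed
  have "\<epsilon> \<longlonglongrightarrow> integral\<^sup>L lborel (\<lambda>x::real. 0)"
    unfolding \<epsilon>_def
  proof (rule integral_dominated_convergence)
    show "AE x in lborel. (\<lambda>n. indicator (- I n) x * laplace_weight x) \<longlonglongrightarrow> 0"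
    proof (rule AE_I2)
      fix x :: real
      show "(\<lambda>n. indicator (- I n) x * laplace_weight x) \<longlonglongrightarrow> 0"
      proof (cases "x > 0")
        case True
        obtain N where N: "real N \<ge> max x (1 / x)" using real_arch_simple by blast
        have "indicator (- I n) x * laplace_weight x = 0" if "n \<ge> N" for n
        proof -
          have *: "real (Suc n) \<ge> x" "real (Suc n) \<ge> 1 / x" using N that by auto
          have "1 / real (Suc n) \<le> x" using *(2) True by (simp add: field_simps)
          with * show ?thesis by (simp add: I_def)
        qed
        thus ?thesis by (intro tendsto_eventually) (auto simp: eventually_sequentially)
      qed (simp add: laplace_weight_def)
    qed
  qed (use integrable_laplace_weight in \<open>auto simp: indicator_def laplace_weight_def\<close>)
  hence \<epsilon>: "\<epsilon> \<longlonglongrightarrow> 0" by simp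
  show ?thesis
  proof (rule holomorphic_uniform_sequence)
    show "open U" by fact
    show "(\<lambda>z. integral (I n) (g z)) holomorphic_on U" for n
      unfolding I_def interval_cbox
    proof (rule leibniz_rule_holomorphic)
      fix z t assume "z \<in> U" "t \<in> cbox (1 / real (Suc n)) (real (Suc n))"
      thus "((\<lambda>z. g z t) has_field_derivative
              (- of_real (exp (- t) / sqrt t) / (2 * csqrt (of_real t + z) ^ 3))) (at z within U)"
        unfolding g_def using np[of z t] nz[of z t]
        by (auto intro!: derivative_eq_intros simp: power3_eq_cube power2_eq_square field_simps simp del: csqrt.simps)
    next
      fix z assume "z \<in> U"
      from cont[OF this, of n] show "g z integrable_on cbox (1 / real (Suc n)) (real (Suc n))"
        unfolding I_def by (simp add: integrable_continuous_real)
    next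
      show "continuous_on (U \<times> cbox (1 / real (Suc n)) (real (Suc n)))
         (\<lambda>(z, t). - of_real (exp (- t) / sqrt t) / (2 * csqrt (of_real t + z) ^ 3))"
      proof -
        define D where "D = U \<times> cbox (1 / real (Suc n)) (real (Suc n))"
        have "continuous_on D (\<lambda>p. csqrt (of_real (snd p) + fst p))"
          unfolding D_def using np
          by (intro continuous_on_compose2[OF continuous_on_csqrt] continuous_intros) auto
        moreover have "\<forall>p\<in>D. sqrt (snd p) \<noteq> 0"
          unfolding D_def using ipos[of _ n] by (force simp: I_def)
        moreover have "\<forall>p\<in>D. 2 * csqrt (of_real (snd p) + fst p) ^ 3 \<noteq> 0"
          unfolding D_def using nz by auto
        ultimately show ?thesis
          unfolding split_beta D_def[symmetric] by (intro continuous_intros)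
      qed
    qed fact
  next
    fix z assume z: "z \<in> U"
    obtain d0 where d0: "d0 > 0" "cball z d0 \<subseteq> U"
      using \<open>open U\<close> z open_contains_cball by blast
    \<comment> \<open>Half the distance from \<open>z\<close> to the real axis: on the ball of
      radius \<open>d\<close> every \<open>w\<close> has |Im w| >= b, hence |x + w| >= b for all
      real \<open>x\<close>, and the discarded part is at most the tail mass
      \<open>\<epsilon> n\<close> over sqrt b.\<close>
    define b where "b = \<bar>Im z\<bar> / 2"
    define d where "d = min d0 b"
    have b: "b > 0" using U[OF z] by (simp add: b_def)
    have d: "d > 0" "cball z d \<subseteq> U" using d0 b by (auto simp: d_def)
    have bound: "norm (integral (I n) (g w) - laplace_bessel w) \<le> \<epsilon> n / sqrt b" if w: "w \<in> cball z d" for w n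
    proof -
      have wU: "w \<in> U" using w d by auto
      have "\<bar>Im z - Im w\<bar> \<le> d" 
        using abs_Im_le_cmod[of "z - w"] w by (simp add: dist_norm)
      hence "\<bar>Im z - Im w\<bar> \<le> \<bar>Im z\<bar> / 2" by (simp add: d_def b_def)
      hence Imw: "\<bar>Im w\<bar> \<ge> b" unfolding b_def by linarith
      have gi: "set_integrable lborel (I n) (g w)"
        using cont[OF wU, of n] unfolding I_def by (rule borel_integrable_atLeastAtMost')
      have ki: "integrable lborel (laplace_kernel w)"
        using U[OF wU] by (intro integrable_laplace_kernel) auto
      have "integral (I n) (g w) - laplace_bessel w =
            (\<integral>x. indicator (I n) x *\<^sub>R g w x - laplace_kernel w x \<partial>lborel)"
        using gi ki unfolding set_borel_integral_eq_integral(2)[OF gi, symmetric]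
        by (simp add: laplace_bessel_def set_lebesgue_integral_def set_integrable_def)
      also have "norm \<dots> \<le> (\<integral>x. norm (indicator (I n) x *\<^sub>R g w x - laplace_kernel w x) \<partial>lborel)"
        by (rule integral_norm_bound)
      also have "\<dots> \<le> (\<integral>x. indicator (- I n) x * laplace_weight x / sqrt b \<partial>lborel)"
      proof (rule integral_mono)
        show "integrable lborel (\<lambda>x. norm (indicator (I n) x *\<^sub>R g w x - laplace_kernel w x))"
          using gi ki by (auto simp: set_integrable_def)
        show "integrable lborel (\<lambda>x. indicator (- I n) x * laplace_weight x / sqrt b)"
          by (intro integrable_divide Bochner_Integration.integrable_bound[OF integrable_laplace_weight])
             (auto simp: indicator_def)
        fix x
        have "b \<le> norm (of_real x + w)"
          using abs_Im_le_cmod[of "of_real x + w"] Imw by simp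
        hence "1 / sqrt (norm (of_real x + w)) \<le> 1 / sqrt b"
          using b by (intro divide_left_mono mult_pos_pos) auto
        hence *: "laplace_weight x * (1 / sqrt (norm (of_real x + w))) \<le> laplace_weight x * (1 / sqrt b)"
          by (intro mult_left_mono) (auto simp: laplace_weight_def indicator_def)
        show "norm (indicator (I n) x *\<^sub>R g w x - laplace_kernel w x) \<le> indicator (- I n) x * laplace_weight x / sqrt b"
        proof (cases "x \<in> I n")
          case True
          thus ?thesis using ipos[OF True] by (simp add: laplace_kernel_def g_def)
        next
          case False
          have "norm (laplace_kernel w x) = laplace_weight x * (1 / sqrt (norm (of_real x + w)))"
            by (simp add: laplace_kernel_def laplace_weight_def norm_divide norm_mult norm_csqrt_eq indicator_def)
          with False * show ?thesis by simp
        qed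
      qed
      also have "\<dots> = \<epsilon> n / sqrt b" by (simp add: \<epsilon>_def)
      finally show ?thesis .
    qed
    have lim: "(\<lambda>n. \<epsilon> n / sqrt b) \<longlonglongrightarrow> 0"
      using tendsto_divide[OF \<epsilon> tendsto_const[of "sqrt b"]] b by simp
    have "uniform_limit (cball z d) (\<lambda>n w. integral (I n) (g w)) laplace_bessel sequentially"
    proof (rule uniform_limitI)
      fix e :: real assume "e > 0"
      hence "\<forall>\<^sub>F n in sequentially. \<epsilon> n / sqrt b < e"
        using lim by (intro order_tendstoD)
      thus "\<forall>\<^sub>F n in sequentially. \<forall>w\<in>cball z d. dist (integral (I n) (g w)) (laplace_bessel w) < e"
        by eventually_elim (unfold dist_norm, blast intro: le_less_trans bound)
    qed
    with d show "\<exists>d. 0 < d \<and> cball z d \<subseteq> U \<and>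
        uniform_limit (cball z d) (\<lambda>n z. integral (I n) (g z)) laplace_bessel sequentially"
      by blast
  qed
qed

section \<open>Values on the real axis in terms of I_0 and K_0\<close>

lemma integrable_exp_neg_cosh:
  fixes t :: real
  assumes "t > 0"
  shows "set_integrable lborel {0<..} (\<lambda>u. exp (- t * cosh u))"
proof -
  have "integrable lborel (\<lambda>u. indicator {0..} u * exp (- t * u))"
    using has_integral_exp_minus_to_infinity[OF assms, of 0]
    by (intro integrable_lborel_indicator_nonneg) (auto simp: integrable_on_def)
  thus ?thesis
    unfolding set_integrable_def
  proof (rule Bochner_Integration.integrable_bound)
    show "AE u in lborel. norm (indicator {0<..} u *\<^sub>R exp (- t * cosh u)) \<le> norm (indicator {0..} u * exp (- t * u))"
    proof (rule AE_I2)
      fix u :: real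
      have "u \<le> cosh u" if "u > 0"
      proof -
        \<comment> \<open>Averaging the two exponential bounds gives cosh u >= 1 + u^2 / 4, and 1 +
          u^2 / 4 - u = (u - 2)^2 / 4.\<close>
        have "1 + u + u\<^sup>2 / 2 \<le> exp u" using exp_lower_Taylor_quadratic[of u] that by simp
        moreover have "1 - u \<le> exp (- u)" using exp_ge_add_one_self[of "- u"] by simp
        moreover have "0 \<le> (u - 2)\<^sup>2" by simp
        ultimately show ?thesis by (simp add: cosh_def power2_eq_square algebra_simps)
      qed
      thus "norm (indicator {0<..} u *\<^sub>R exp (- t * cosh u)) \<le> norm (indicator {0..} u * exp (- t * u))"
        using assms by (auto simp: indicator_def)
    qed
  qed (auto simp: cosh_def)
qed

text \<open>Substitute x = t (cosh u + s). As s^2 = 1, x (x - 2 s t) = (t sinh u)^2, so the root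
  cancels against dx and only the exponential remains. The sign s = - 1 serves the positive axis; s
  = 1 serves the range x > 2 t on the negative axis.\<close>

lemma bessel_K0_substitution:
  assumes t: "t > 0" and s: "s = 1 \<or> s = - 1"
  defines "f \<equiv> (\<lambda>x. exp (- x) / (sqrt x * sqrt (x - 2 * s * t)))"
  shows "set_integrable lborel {t * (1 + s)<..} f"
    and "(LBINT x:{t * (1 + s)<..}. f x) = exp (- s * t) * bessel_K0 t"
proof -
  define g where "g = (\<lambda>u. t * (cosh u + s))"
  define g' where "g' = (\<lambda>u. t * sinh u)"
  have pos: "g u > 0" "g u - 2 * s * t > 0" if "u > 0" for u
  proof -
    have "cosh u > 1" using cosh_real_strict_mono[of 0 u] that by simp
    moreover have "g u - 2 * s * t = t * (cosh u - s)" by (simp add: g_def algebra_simps)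
    ultimately show "g u > 0" "g u - 2 * s * t > 0" using s t by (auto simp: g_def)
  qed
  have fg: "f (g u) * g' u = exp (- s * t) * exp (- t * cosh u)" if "u > 0" for u
  proof -
    have "sqrt (g u) * sqrt (g u - 2 * s * t) = sqrt ((t * sinh u)\<^sup>2)"
    proof -
      have "g u * (g u - 2 * s * t) = (t * sinh u)\<^sup>2"
        using s by (auto simp: g_def power_mult_distrib sinh_square_eq) (simp_all add: algebra_simps power2_eq_square)
      thus ?thesis by (simp flip: real_sqrt_mult)
    qed
    also have "\<dots> = t * sinh u" using t that by simp
    finally show ?thesis
      using that t by (simp add: f_def g'_def g_def exp_add[symmetric] algebra_simps)
  qed
  have int: "set_integrable lborel (einterval (ereal 0) \<infinity>) (\<lambda>u. f (g u) * g' u)"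
  proof -
    have "set_integrable lborel {0<..} (\<lambda>u. exp (- s * t) * exp (- t * cosh u))"
      using integrable_exp_neg_cosh[OF t] by simp
    also have "?this \<longleftrightarrow> set_integrable lborel {0<..} (\<lambda>u. f (g u) * g' u)"
      by (intro set_integrable_cong) (auto simp: fg)
    finally show ?thesis by simp
  qed
  have A: "((ereal \<circ> g \<circ> real_of_ereal) \<longlongrightarrow> ereal (t * (1 + s))) (at_right (ereal 0))"
  proof -
    have "(g \<longlongrightarrow> g 0) (at_right 0)"
      unfolding g_def by (intro tendsto_intros)
    thus ?thesis by (simp add: ereal_tendsto_simps g_def)
  qed
  have B: "((ereal \<circ> g \<circ> real_of_ereal) \<longlongrightarrow> \<infinity>) (at_left \<infinity>)"
  proof -
    have "filterlim (\<lambda>u. t * (s + cosh u)) at_top at_top"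
      by (intro filterlim_tendsto_pos_mult_at_top[OF tendsto_const t]
                filterlim_tendsto_add_at_top[OF tendsto_const] cosh_real_at_top)
    hence "filterlim g at_top at_top" by (simp add: g_def add.commute)
    thus ?thesis by (simp add: ereal_tendsto_simps)
  qed
  note subst = interval_integral_substitution_nonneg[of "ereal 0" \<infinity> g g' f, OF _ _ _ _ _ _ A B int]
  have D: "(g has_real_derivative g' u) (at u)" "isCont g' u" for u
    unfolding g_def g'_def by (auto intro!: derivative_eq_intros continuous_intros)
  have C: "isCont f (g u)" "0 \<le> f (g u)" if "u > 0" for u
    using pos[OF that] unfolding f_def by (auto intro!: continuous_intros)
  have N: "0 \<le> g' u" if "u \<ge> 0" for u
    using that t by (simp add: g'_def)
  show "set_integrable lborel {t * (1 + s)<..} f"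
    using subst(1) D C N by simp
  have "(LBINT x=ereal (t * (1 + s))..\<infinity>. f x) = (LBINT u=ereal 0..\<infinity>. f (g u) * g' u)"
    using subst(2) D C N by simp
  hence "(LBINT x:{t * (1 + s)<..}. f x) = (LBINT u:{0<..}. f (g u) * g' u)"
    by (simp only: interval_integral_to_infinity_eq)
  also have "\<dots> = (LBINT u:{0<..}. exp (- s * t) * exp (- t * cosh u))"
    by (intro set_lebesgue_integral_cong) (auto simp: fg)
  finally show "(LBINT x:{t * (1 + s)<..}. f x) = exp (- s * t) * bessel_K0 t"
    by (simp add: bessel_K0_def)
qed

text \<open>Here x = t (1 - cos u) and x (2 t - x) = (t sin u)^2, so again the root cancels against
  dx. This is the range between the two branch points 0 and 2 t that arises on the negative
  axis.\<close>

lemma bessel_I0_substitution: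
  assumes t: "t > 0"
  defines "f \<equiv> (\<lambda>x. exp (- x) / (sqrt x * sqrt (2 * t - x)))"
  shows "set_integrable lborel {0<..<2 * t} f"
    and "(LBINT x:{0<..<2 * t}. f x) = exp (- t) * (pi * bessel_I0 t)"
proof -
  define g where "g = (\<lambda>u. t * (1 - cos u))"
  define g' where "g' = (\<lambda>u. t * sin u)"
  have pos: "g u > 0" "2 * t - g u > 0" if "u > 0" "u < pi" for u
  proof -
    have "cos u < 1" using cos_monotone_0_pi[of 0 u] that by simp
    moreover have "cos u > -1" using cos_monotone_0_pi[of u pi] that by simp
    moreover have "2 * t - g u = t * (1 + cos u)" by (simp add: g_def algebra_simps)
    ultimately show "g u > 0" "2 * t - g u > 0" using t by (auto simp: g_def)
  qed
  have fg: "f (g u) * g' u = exp (- t) * exp (t * cos u)" if "u > 0" "u < pi" for u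
  proof -
    have "sqrt (g u) * sqrt (2 * t - g u) = sqrt ((t * sin u)\<^sup>2)"
    proof -
      have "g u * (2 * t - g u) = (t * sin u)\<^sup>2"
        by (simp add: g_def power_mult_distrib sin_squared_eq) (simp add: algebra_simps power2_eq_square)
      thus ?thesis by (simp flip: real_sqrt_mult)
    qed
    also have "\<dots> = t * sin u" using t sin_gt_zero[OF that] by simp
    finally show ?thesis
      using sin_gt_zero[OF that] t by (simp add: f_def g'_def g_def exp_add[symmetric] algebra_simps)
  qed
  have int0: "set_integrable lborel {0..pi} (\<lambda>u. exp (t * cos u))"
    by (intro borel_integrable_atLeastAtMost' continuous_intros)
  have int: "set_integrable lborel (einterval (ereal 0) (ereal pi)) (\<lambda>u. f (g u) * g' u)"
  proof -
    have "set_integrable lborel {0<..<pi} (\<lambda>u. exp (- t) * exp (t * cos u))"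
      using set_integrable_subset[OF int0, of "{0<..<pi}"] by (simp add: greaterThanLessThan_subseteq_atLeastAtMost_iff)
    also have "?this \<longleftrightarrow> set_integrable lborel {0<..<pi} (\<lambda>u. f (g u) * g' u)"
      by (intro set_integrable_cong) (auto simp: fg)
    finally show ?thesis by simp
  qed
  have gl: "(g \<longlongrightarrow> g a) (at a within S)" for a S
    unfolding g_def by (intro tendsto_intros)
  have A: "((ereal \<circ> g \<circ> real_of_ereal) \<longlongrightarrow> ereal 0) (at_right (ereal 0))"
    using gl[of 0 "{0<..}"] by (simp add: ereal_tendsto_simps g_def)
  have B: "((ereal \<circ> g \<circ> real_of_ereal) \<longlongrightarrow> ereal (2 * t)) (at_left (ereal pi))"
    using gl[of pi "{..<pi}"] by (simp add: ereal_tendsto_simps g_def mult.commute)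
  note subst = interval_integral_substitution_nonneg[of "ereal 0" "ereal pi" g g' f, OF _ _ _ _ _ _ A B int]
  have D: "(g has_real_derivative g' u) (at u)" "isCont g' u" for u
    unfolding g_def g'_def by (auto intro!: derivative_eq_intros continuous_intros)
  have C: "isCont f (g u)" "0 \<le> f (g u)" if "u > 0" "u < pi" for u
    using pos[OF that] unfolding f_def by (auto intro!: continuous_intros)
  have N: "0 \<le> g' u" if "u \<ge> 0" "u \<le> pi" for u
    using that t by (simp add: g'_def sin_ge_zero)
  show "set_integrable lborel {0<..<2 * t} f"
    using subst(1) D C N by simp
  have "(LBINT x=ereal 0..ereal (2 * t). f x) = (LBINT u=ereal 0..ereal pi. f (g u) * g' u)"
    using subst(2) D C N by simp
  hence "(LBINT x:{0<..<2 * t}. f x) = (LBINT u:{0<..<pi}. f (g u) * g' u)"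
    using t by (simp add: interval_lebesgue_integral_def)
  also have "\<dots> = (LBINT u:{0<..<pi}. exp (- t) * exp (t * cos u))"
    by (intro set_lebesgue_integral_cong) (auto simp: fg)
  also have "\<dots> = exp (- t) * (LBINT u:{0..pi}. exp (t * cos u))"
    using interval_integral_Icc[of 0 pi "\<lambda>u. exp (t * cos u)"]
          interval_integral_Ioo[of 0 pi "\<lambda>u. exp (t * cos u)"]
    by (simp add: zero_ereal_def[symmetric])
  finally show "(LBINT x:{0<..<2 * t}. f x) = exp (- t) * (pi * bessel_I0 t)"
    by (simp add: bessel_I0_def)
qed

lemma laplace_bessel_pos:
  assumes "t > 0"
  shows "laplace_bessel (of_real (2 * t)) = of_real (exp t * bessel_K0 t)"
proof -
  have "laplace_kernel (of_real (2 * t)) x =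
        of_real (indicator {0<..} x *\<^sub>R (exp (- x) / (sqrt x * sqrt (x + 2 * t))))" for x
    using assms by (simp add: laplace_kernel_def indicator_def flip: of_real_add of_real_mult)
  hence "laplace_bessel (of_real (2 * t)) =
      of_real (LBINT x:{0<..}. exp (- x) / (sqrt x * sqrt (x + 2 * t)))"
    unfolding laplace_bessel_def set_lebesgue_integral_def
    by (subst integral_complex_of_real[symmetric], intro Bochner_Integration.integral_cong) (simp_all only:)
  thus ?thesis
    using bessel_K0_substitution(2)[OF assms, of "-1"] by simp
qed

text \<open>The integral splits at x = 2 t. Below that point csqrt (x - 2 t) = i sqrt (2 t - x),
  whose reciprocal contributes the I_0 term with factor - i; above it the root is real and gives
  K_0. Up to the exponential factor this is the continuation of K_0 to - t through the upper half
  plane.\<close>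

lemma laplace_bessel_neg:
  assumes t: "t > 0"
  shows "laplace_bessel (of_real (- 2 * t)) =
    of_real (exp (- t)) * (of_real (bessel_K0 t) - \<i> * of_real (pi * bessel_I0 t))"
proof -
  define f1 f2 where "f1 = (\<lambda>x. exp (- x) / (sqrt x * sqrt (2 * t - x)))"
    and "f2 = (\<lambda>x. exp (- x) / (sqrt x * sqrt (x - 2 * t)))"
  define h1 h2 where "h1 = (\<lambda>x. indicator {0<..<2 * t} x * f1 x)"
    and "h2 = (\<lambda>x. indicator {2 * t<..} x * f2 x)"
  have i: "integrable lborel h1" "integrable lborel h2"
    using bessel_I0_substitution(1)[OF t] bessel_K0_substitution(1)[OF t, of 1]
    by (auto simp: h1_def h2_def f1_def f2_def set_integrable_def mult.commute)
  have v: "integral\<^sup>L lborel h1 = exp (- t) * (pi * bessel_I0 t)"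
          "integral\<^sup>L lborel h2 = exp (- t) * bessel_K0 t"
    using bessel_I0_substitution(2)[OF t] bessel_K0_substitution(2)[OF t, of 1]
    by (auto simp: h1_def h2_def f1_def f2_def set_lebesgue_integral_def mult.commute)
  have "laplace_bessel (of_real (- 2 * t)) = (\<integral>x. - \<i> * of_real (h1 x) + of_real (h2 x) \<partial>lborel)"
    unfolding laplace_bessel_def
  proof (rule integral_cong_AE)
    show "AE x in lborel. laplace_kernel (of_real (- 2 * t)) x = - \<i> * of_real (h1 x) + of_real (h2 x)"
      using AE_lborel_singleton[of "2 * t"]
    proof eventually_elim
      case (elim x)
      have "csqrt (of_real x + of_real (- 2 * t)) = 
              (if x < 2 * t then \<i> * of_real (sqrt (2 * t - x)) else of_real (sqrt (x - 2 * t)))"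
        by (simp flip: of_real_add of_real_mult)
      thus ?case using elim t
        by (auto simp: laplace_kernel_def h1_def h2_def f1_def f2_def indicator_def field_simps)
    qed
  qed (use i in \<open>auto simp: borel_measurable_integrable\<close>)
  also have "\<dots> = - \<i> * of_real (integral\<^sup>L lborel h1) + of_real (integral\<^sup>L lborel h2)"
    using i by simp
  finally show ?thesis by (simp add: v algebra_simps)
qed

section \<open>The product of K_0(z) and K_0(- z) in the lower half plane\<close>

lemma laplace_bessel_measurable [measurable]: "laplace_bessel \<in> borel_measurable borel"
  unfolding laplace_bessel_def laplace_kernel_def by measurable

text \<open>This is i K_0(z) K_0(- z): the factors exp z and exp (- z) carried by the two values of
  \<open>laplace_bessel\<close> cancel. At t > 0 it takes the boundary value from the lower half
  plane, since then - 2 z approaches - 2 t from above.\<close>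

definition bessel_product :: "complex \<Rightarrow> complex" where
  "bessel_product z = \<i> * (laplace_bessel (2 * z) * laplace_bessel (- 2 * z))"

lemma bessel_product_measurable [measurable]: "bessel_product \<in> borel_measurable borel"
  unfolding bessel_product_def by measurable

lemma bessel_product_of_real:
  assumes "t > 0"
  shows "bessel_product (of_real t) =
    of_real (bessel_K0 t) * (of_real (pi * bessel_I0 t) + \<i> * of_real (bessel_K0 t))"
proof -
  have "bessel_product (of_real t) =
        \<i> * (laplace_bessel (of_real (2 * t)) * laplace_bessel (of_real (- 2 * t)))"
    by (simp add: bessel_product_def)
  also have "\<dots> = of_real (exp t * exp (- t)) * (of_real (bessel_K0 t) *
        (of_real (pi * bessel_I0 t) + \<i> * of_real (bessel_K0 t)))"
    unfolding laplace_bessel_pos[OF assms] laplace_bessel_neg[OF assms]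
    by (simp add: algebra_simps)
  also have "exp t * exp (- t) = 1" by (simp flip: exp_add)
  finally show ?thesis by simp
qed

lemma bessel_product_holomorphic: "bessel_product holomorphic_on {z. Im z < 0}"
proof -
  have up: "laplace_bessel holomorphic_on {z. Im z > 0}"
    by (rule laplace_bessel_holomorphic) (auto simp: open_halfspace_Im_gt convex_halfspace_Im_gt)
  have lo: "laplace_bessel holomorphic_on {z. Im z < 0}"
    by (rule laplace_bessel_holomorphic) (auto simp: open_halfspace_Im_lt convex_halfspace_Im_lt)
  have "(laplace_bessel \<circ> (\<lambda>z. 2 * z)) holomorphic_on {z. Im z < 0}"
    by (rule holomorphic_on_compose_gen[OF _ lo]) (auto intro!: holomorphic_intros)
  moreover have "(laplace_bessel \<circ> (\<lambda>z. - 2 * z)) holomorphic_on {z. Im z < 0}"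
    by (rule holomorphic_on_compose_gen[OF _ up]) (auto intro!: holomorphic_intros)
  ultimately show ?thesis
    unfolding bessel_product_def o_def by (intro holomorphic_intros)
qed

text \<open>Replacing \<open>z\<close> by - cnj z interchanges the two factors up to conjugation;
  the minus sign is that of cnj i = - i.\<close>

lemma bessel_product_reflect:
  assumes "Im z \<noteq> 0"
  shows "bessel_product (- cnj z) = - cnj (bessel_product z)"
proof -
  have "laplace_bessel (cnj (2 * z)) = cnj (laplace_bessel (2 * z))"
       "laplace_bessel (cnj (- 2 * z)) = cnj (laplace_bessel (- 2 * z))"
    using assms by (intro laplace_bessel_cnj; simp)+
  thus ?thesis by (simp add: bessel_product_def)
qed

lemma bessel_product_boundary:
  assumes "t > 0" "y \<longlonglongrightarrow> 0" "\<And>n. y n > 0"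
  shows "(\<lambda>n. bessel_product (Complex t (- y n))) \<longlonglongrightarrow> bessel_product (of_real t)"
proof -
  have y: "(\<lambda>n. 2 * y n) \<longlonglongrightarrow> 0" using tendsto_mult_left[OF assms(2), of 2] by simp
  have 1: "(\<lambda>n. laplace_bessel (Complex (2 * t) (2 * y n))) \<longlonglongrightarrow> laplace_bessel (of_real (2 * t))"
    using assms by (intro laplace_bessel_boundary y) (auto intro: less_imp_le)
  \<comment> \<open>The argument 2 z approaches the positive axis from below, where the boundary
    lemma does not apply directly. Conjugation moves it above the axis, and the limit is unchanged
    because it is real.\<close>
  have cj: "laplace_bessel (2 * Complex t (- y n)) = cnj (laplace_bessel (Complex (2 * t) (2 * y n)))" for n
  proof -
    have "2 * Complex t (- y n) = cnj (Complex (2 * t) (2 * y n))"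
      by (simp add: complex_eq_iff)
    moreover have "Im (Complex (2 * t) (2 * y n)) \<noteq> 0" using assms(3)[of n] by simp
    ultimately show ?thesis using laplace_bessel_cnj by metis
  qed
  have 1: "(\<lambda>n. laplace_bessel (2 * Complex t (- y n))) \<longlonglongrightarrow> laplace_bessel (2 * of_real t)"
  proof -
    have "cnj (laplace_bessel (of_real (2 * t))) = laplace_bessel (of_real (2 * t))"
      unfolding laplace_bessel_pos[OF assms(1)] by (rule complex_cnj_complex_of_real)
    moreover have "2 * of_real t = (of_real (2 * t) :: complex)" by simp
    ultimately show ?thesis unfolding cj using tendsto_cnj[OF 1] by (simp only:)
  qed
  have 2: "(\<lambda>n. laplace_bessel (Complex (- 2 * t) (2 * y n))) \<longlonglongrightarrow> laplace_bessel (of_real (- 2 * t))"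
    using assms by (intro laplace_bessel_boundary y) (auto intro: less_imp_le)
  have "- 2 * Complex t (- y n) = Complex (- 2 * t) (2 * y n)" for n
    by (simp add: complex_eq_iff)
  moreover have "- 2 * of_real t = (of_real (- 2 * t) :: complex)" by simp
  ultimately have 2: "(\<lambda>n. laplace_bessel (- 2 * Complex t (- y n))) \<longlonglongrightarrow> laplace_bessel (- 2 * of_real t)"
    using 2 by (simp only:)
  show ?thesis unfolding bessel_product_def by (intro tendsto_intros 1 2)
qed

lemma norm_bessel_product_le:
  assumes "0 < d" "d < 1/2"
  obtains B where "B \<ge> 0" "\<And>z. z \<noteq> 0 \<Longrightarrow> norm (bessel_product z) \<le> B * norm z powr (- 2 * d)"
proof -
  define A where "A = (\<integral>x. gap_kernel d 1 x \<partial>lborel)"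
  have A: "A \<ge> 0" unfolding A_def by (intro Bochner_Integration.integral_nonneg gap_kernel_nonneg)
  have "norm (bessel_product z) \<le> (2 powr (- d) * A)\<^sup>2 * norm z powr (- 2 * d)" if "z \<noteq> 0" for z
  proof -
    have le: "norm (laplace_bessel (2 * z)) \<le> norm (2 * z) powr (- d) * A"
       "norm (laplace_bessel (- 2 * z)) \<le> norm (- 2 * z) powr (- d) * A"
      unfolding A_def using that assms by (intro norm_laplace_bessel_le; simp)+
    have "norm (bessel_product z) = norm (laplace_bessel (2 * z)) * norm (laplace_bessel (- 2 * z))"
      unfolding bessel_product_def norm_mult by simp
    also have "\<dots> \<le> (norm (2 * z) powr (- d) * A) * (norm (- 2 * z) powr (- d) * A)"
      using A by (intro mult_mono le) auto
    also have "\<dots> = (2 powr (- d) * A)\<^sup>2 * (norm z powr (- d) * norm z powr (- d))"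
      by (simp add: norm_mult powr_mult power2_eq_square)
    also have "norm z powr (- d) * norm z powr (- d) = norm z powr (- 2 * d)"
      by (subst powr_add[symmetric]) simp
    finally show ?thesis .
  qed
  thus ?thesis by (intro that[of "(2 powr (- d) * A)\<^sup>2"]) auto
qed

section \<open>Integrals of functions odd under reflection in the imaginary axis\<close>

text \<open>Cauchy's theorem on the rectangle with corners \<open>\<plusminus> X - i y\<close> and \<open>\<plusminus> X - i (X + y)\<close>, on whose other
  three sides \<open>\<bar>z\<bar> \<ge> X\<close>; by the symmetry the integral over the top side is purely imaginary.\<close>

lemma reflection_odd_segment_integral:
  fixes f :: "complex \<Rightarrow> complex"
  assumes hol: "f holomorphic_on {z. Im z < 0}"
    and sym: "\<And>z. Im z < 0 \<Longrightarrow> f (- cnj z) = - cnj (f z)"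
    and bound: "\<And>z. Im z < 0 \<Longrightarrow> norm (f z) \<le> C * norm z powr (- 2)"
    and X: "X > 0" and y: "y > 0"
  obtains J where "((\<lambda>x. Im (f (Complex x (- y)))) has_integral J) {0..X}" "\<bar>J\<bar> \<le> 2 * C / X"
proof -
  define H where "H = {z. Im z < 0}"
  have H: "open H" "convex H" by (auto simp: H_def open_halfspace_Im_lt convex_halfspace_Im_lt)
  \<comment> \<open>Cauchy's theorem enters as the existence of a primitive on the convex half
    plane; the integral over each side becomes an increment of \<open>\<Phi>\<close>.\<close>
  obtain \<Phi> where \<Phi>0: "\<And>z. z \<in> H \<Longrightarrow> (\<Phi> has_field_derivative f z) (at z within H)"
    using holomorphic_convex_primitive'[OF H(2,1)] hol unfolding H_def by metis
  have \<Phi>: "(\<Phi> has_field_derivative f z) (at z)" if "z \<in> H" for z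
    using \<Phi>0[OF that] at_within_open[OF that H(1)] by simp
  have C: "C \<ge> 0" using bound[of "- \<i>"] by simp (smt (verit) norm_ge_zero)
  have incr: "norm (\<Phi> a - \<Phi> b) \<le> C / X\<^sup>2 * norm (a - b)"
    if "closed_segment a b \<subseteq> H" "\<And>z. z \<in> closed_segment a b \<Longrightarrow> X \<le> norm z" for a b
  proof (rule field_differentiable_bound[of "closed_segment a b" \<Phi> f])
    fix z assume z: "z \<in> closed_segment a b"
    show "(\<Phi> has_field_derivative f z) (at z within closed_segment a b)"
      using \<Phi> z that by (blast intro: has_field_derivative_at_within)
    have "norm (f z) \<le> C * norm z powr (- 2)" using bound z that by (auto simp: H_def)
    also have "\<dots> \<le> C * X powr (- 2)"
      using C X that(2)[OF z] by (intro mult_left_mono powr_mono2') auto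
    also have "X powr (- 2) = 1 / X\<^sup>2"
      using X by (simp add: powr_minus powr_numeral inverse_eq_divide)
    finally show "norm (f z) \<le> C / X\<^sup>2" by simp
  qed auto
  have halfplanes: "convex {z. Im z \<le> c}" "convex {z. Re z \<ge> c}" "convex {z. Re z \<le> c}" for c
    by (auto simp: convex_halfspace_Im_le convex_halfspace_Re_ge convex_halfspace_Re_le)
  \<comment> \<open>With this depth the vertical sides have length \<open>X\<close> and the bottom
    side lies in Im z <= - X, so the three remaining sides contribute C / X, 2 C / X and C /
    X.\<close>
  define Y where "Y = X + y"
  have seg: "closed_segment a b \<subseteq> H" if "Im a \<le> - y" "Im b \<le> - y" for a b
  proof -
    have "closed_segment a b \<subseteq> {z. Im z \<le> - y}"
      using that by (intro closed_segment_subset halfplanes) auto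
    thus ?thesis using y by (auto simp: H_def)
  qed
  have right: "norm (\<Phi> (Complex X (- y)) - \<Phi> (Complex X (- Y))) \<le> C / X"
  proof -
    have "closed_segment (Complex X (- y)) (Complex X (- Y)) \<subseteq> {z. Re z \<ge> X}"
      by (intro closed_segment_subset halfplanes) auto
    hence "norm (\<Phi> (Complex X (- y)) - \<Phi> (Complex X (- Y))) \<le> C / X\<^sup>2 * norm (Complex X (- y) - Complex X (- Y))"
      using X by (intro incr seg) (auto simp: Y_def dest!: subsetD intro: order.trans[OF _ complex_Re_le_cmod])
    also have "norm (Complex X (- y) - Complex X (- Y)) = X"
      using X by (simp add: complex_diff Y_def cmod_def)
    finally show ?thesis using X by (simp add: power2_eq_square)
  qed
  have left: "norm (\<Phi> (Complex (- X) (- Y)) - \<Phi> (Complex (- X) (- y))) \<le> C / X"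
  proof -
    have sub: "closed_segment (Complex (- X) (- Y)) (Complex (- X) (- y)) \<subseteq> {z. Re z \<le> - X}"
      by (intro closed_segment_subset halfplanes) auto
    have "X \<le> norm z" if "z \<in> closed_segment (Complex (- X) (- Y)) (Complex (- X) (- y))" for z
      using sub that abs_Re_le_cmod[of z] by fastforce
    hence "norm (\<Phi> (Complex (- X) (- Y)) - \<Phi> (Complex (- X) (- y))) \<le> C / X\<^sup>2 * norm (Complex (- X) (- Y) - Complex (- X) (- y))"
      using X by (intro incr seg) (auto simp: Y_def)
    also have "norm (Complex (- X) (- Y) - Complex (- X) (- y)) = X"
      using X by (simp add: complex_diff Y_def cmod_def)
    finally show ?thesis using X by (simp add: power2_eq_square)
  qed
  have bottom: "norm (\<Phi> (Complex X (- Y)) - \<Phi> (Complex (- X) (- Y))) \<le> 2 * C / X"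
  proof -
    have sub: "closed_segment (Complex X (- Y)) (Complex (- X) (- Y)) \<subseteq> {z. Im z \<le> - X}"
      using y by (intro closed_segment_subset halfplanes) (auto simp: Y_def)
    have "X \<le> norm z" if "z \<in> closed_segment (Complex X (- Y)) (Complex (- X) (- Y))" for z
      using sub that abs_Im_le_cmod[of z] by fastforce
    hence "norm (\<Phi> (Complex X (- Y)) - \<Phi> (Complex (- X) (- Y))) \<le> C / X\<^sup>2 * norm (Complex X (- Y) - Complex (- X) (- Y))"
      using X by (intro incr seg) (auto simp: Y_def)
    also have "norm (Complex X (- Y) - Complex (- X) (- Y)) = 2 * X"
      using X by (simp add: complex_diff cmod_def real_sqrt_mult)
    finally show ?thesis using X by (simp add: power2_eq_square mult.commute)
  qed
  \<comment> \<open>By the symmetry, f (x - i y) + f (- x - i y) = 2 i Im (f (x - i y)); hence half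
    the imaginary part of the increment over the symmetric segment is a primitive of Im f.\<close>
  define \<Psi> where "\<Psi> = (\<lambda>x. Im (\<Phi> (Complex x (- y)) - \<Phi> (Complex (- x) (- y))) / 2)"
  have der: "(\<Psi> has_vector_derivative Im (f (Complex x (- y)))) (at x within {0..X})" for x
  proof -
    have 1: "((\<lambda>x. \<Phi> (Complex x (- y))) has_vector_derivative 1 * f (Complex x (- y))) (at x within {0..X})"
      using y by (intro field_vector_diff_chain_within[unfolded o_def, of "\<lambda>x. Complex x (- y)"]
                        has_field_derivative_at_within[OF \<Phi>])
                 (auto simp: H_def has_vector_derivative_complex_iff intro!: derivative_eq_intros)
    have 2: "((\<lambda>x. \<Phi> (Complex (- x) (- y))) has_vector_derivative (- 1) * f (Complex (- x) (- y))) (at x within {0..X})"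
      using y by (intro field_vector_diff_chain_within[unfolded o_def, of "\<lambda>x. Complex (- x) (- y)"]
                        has_field_derivative_at_within[OF \<Phi>])
                 (auto simp: H_def has_vector_derivative_complex_iff intro!: derivative_eq_intros)
    have "- cnj (Complex x (- y)) = Complex (- x) (- y)" by (simp add: complex_eq_iff)
    hence "f (Complex (- x) (- y)) = - cnj (f (Complex x (- y)))"
      using sym[of "Complex x (- y)"] y by simp
    hence "Im (1 * f (Complex x (- y)) - (- 1) * f (Complex (- x) (- y))) / 2 = Im (f (Complex x (- y)))"
      by simp
    with bounded_linear.has_vector_derivative[OF
        bounded_linear_compose[OF bounded_linear_divide[of 2] bounded_linear_Im] has_vector_derivative_diff[OF 1 2]]
    show ?thesis unfolding \<Psi>_def by (simp only:)
  qed
  have "((\<lambda>x. Im (f (Complex x (- y)))) has_integral \<Psi> X - \<Psi> 0) {0..X}"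
    using X der by (intro fundamental_theorem_of_calculus) auto
  moreover have "\<bar>\<Psi> X - \<Psi> 0\<bar> \<le> 2 * C / X"
  proof -
    have "norm ((\<Phi> (Complex X (- y)) - \<Phi> (Complex X (- Y))) + (\<Phi> (Complex X (- Y)) - \<Phi> (Complex (- X) (- Y)))
        + (\<Phi> (Complex (- X) (- Y)) - \<Phi> (Complex (- X) (- y)))) \<le> C / X + 2 * C / X + C / X"
      by (intro norm_triangle_mono right bottom left)
    hence "norm (\<Phi> (Complex X (- y)) - \<Phi> (Complex (- X) (- y))) \<le> 4 * C / X"
      by simp
    hence "\<bar>Im (\<Phi> (Complex X (- y)) - \<Phi> (Complex (- X) (- y)))\<bar> \<le> 4 * C / X"
      by (rule order.trans[OF abs_Im_le_cmod])
    thus ?thesis by (simp add: \<Psi>_def)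
  qed
  ultimately show ?thesis by (rule that)
qed

text \<open>The segment lemma is applied at height 1 / (n + 1) and width n + 1 at once: its bound
  tends to 0, while dominated convergence identifies the limit with the half-line integral. The
  exponent -1/2 controls the integrand near 0 and -2 controls it at infinity.\<close>

lemma reflection_odd_half_line_integral:
  fixes f :: "complex \<Rightarrow> complex"
  assumes hol: "f holomorphic_on {z. Im z < 0}" and [measurable]: "f \<in> borel_measurable borel"
    and sym: "\<And>z. Im z < 0 \<Longrightarrow> f (- cnj z) = - cnj (f z)"
    and bound: "\<And>z. z \<noteq> 0 \<Longrightarrow> norm (f z) \<le> C * norm z powr (- 2)"
      "\<And>z. z \<noteq> 0 \<Longrightarrow> norm (f z) \<le> C * norm z powr (- 1/2)"
    and lim: "\<And>t. t > 0 \<Longrightarrow> (\<lambda>n. f (Complex t (- 1 / real (Suc n)))) \<longlonglongrightarrow> f (of_real t)"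
  shows "set_integrable lborel {0<..} (\<lambda>t. norm (f (of_real t)))"
    and "(LBINT t:{0<..}. Im (f (of_real t))) = 0"
proof -
  \<comment> \<open>Both bounds decrease in |z| >= Re z, so a majorant in the real part alone covers
    all heights, the real axis included.\<close>
  define w where "w = (\<lambda>x::real. C * (indicator {0<..1} x * x powr (- 1/2) + indicator {1..} x * x powr (- 2)))"
  have "integrable lborel (\<lambda>x::real. indicator {0<..1} x * x powr (- 1/2))"
    by (intro integrable_lborel_indicator_nonneg integrable_on_powr_from_0') auto
  moreover have "integrable lborel (\<lambda>x::real. indicator {1..} x * x powr (- 2))"
    using has_integral_powr_to_inf[of "- 2" 1]
    by (intro integrable_lborel_indicator_nonneg) (auto simp: integrable_on_def)
  ultimately have w: "integrable lborel w"
    unfolding w_def by (intro integrable_mult_right Bochner_Integration.integrable_add)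
  have C: "C \<ge> 0" using bound(1)[of 1] by simp (smt (verit) norm_ge_zero)
  have dom: "norm (f z) \<le> w (Re z)" if "Re z > 0" for z
  proof -
    have z: "z \<noteq> 0" "Re z \<le> norm z" using that complex_Re_le_cmod[of z] by auto
    show ?thesis
    proof (cases "Re z \<le> 1")
      case True
      have "norm (f z) \<le> C * norm z powr (- 1/2)" by (intro bound z)
      also have "\<dots> \<le> C * Re z powr (- 1/2)"
        using C z that by (intro mult_left_mono powr_mono2') auto
      also have "\<dots> \<le> w (Re z)"
        using True that C by (simp add: w_def indicator_def)
      finally show ?thesis .
    next
      case False
      have "norm (f z) \<le> C * norm z powr (- 2)" by (intro bound z)
      also have "\<dots> \<le> C * Re z powr (- 2)"
        using C z that by (intro mult_left_mono powr_mono2') auto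
      also have "\<dots> = w (Re z)"
        using False by (simp add: w_def indicator_def)
      finally show ?thesis .
    qed
  qed
  show "set_integrable lborel {0<..} (\<lambda>t. norm (f (of_real t)))"
    unfolding set_integrable_def
  proof (rule Bochner_Integration.integrable_bound[OF w])
    have "norm (f (of_real t)) \<le> \<bar>w t\<bar>" if "t > 0" for t
      using dom[of "of_real t"] that by simp
    thus "AE t in lborel. norm (indicator {0<..} t *\<^sub>R norm (f (of_real t))) \<le> norm (w t)"
      by (auto simp: indicator_def)
  qed auto
  define s where "s = (\<lambda>n x. indicator {0..real (Suc n)} x * Im (f (Complex x (- 1 / real (Suc n)))))"
  have Cm [measurable]: "(\<lambda>x. Complex x c) \<in> borel_measurable borel" for c
    by (intro borel_measurable_continuous_onI continuous_intros)
  have s: "\<bar>integral\<^sup>L lborel (s n)\<bar> \<le> 2 * C / real (Suc n)" for n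
  proof -
    obtain J where J: "((\<lambda>x. Im (f (Complex x (- (1 / real (Suc n)))))) has_integral J) {0..real (Suc n)}"
        "\<bar>J\<bar> \<le> 2 * C / real (Suc n)"
      by (rule reflection_odd_segment_integral[OF hol sym, of C "real (Suc n)" "1 / real (Suc n)"])
         (auto intro!: bound(1))
    have si: "set_integrable lborel {0..real (Suc n)} (\<lambda>x. Im (f (Complex x (- 1 / real (Suc n)))))"
      by (intro borel_integrable_atLeastAtMost' continuous_intros
            continuous_on_compose2[OF holomorphic_on_imp_continuous_on[OF hol]]) auto
    have "integral\<^sup>L lborel (s n) = integral {0..real (Suc n)} (\<lambda>x. Im (f (Complex x (- 1 / real (Suc n)))))"
      unfolding set_borel_integral_eq_integral(2)[OF si, symmetric]
      by (simp add: s_def set_lebesgue_integral_def)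
    also have "\<dots> = J" using J(1) by (simp add: integral_unique)
    finally show ?thesis using J(2) by simp
  qed
  have "(\<lambda>n. 2 * C / real (Suc n)) \<longlonglongrightarrow> 0"
    using LIMSEQ_Suc[OF lim_const_over_n[of "2 * C"]] by simp
  hence s0: "(\<lambda>n. integral\<^sup>L lborel (s n)) \<longlonglongrightarrow> 0"
    by (rule Lim_null_comparison[rotated]) (use s in auto)
  have "(\<lambda>n. integral\<^sup>L lborel (s n)) \<longlonglongrightarrow> (\<integral>x. indicator {0<..} x * Im (f (of_real x)) \<partial>lborel)"
  proof (rule integral_dominated_convergence[OF _ _ w])
    show "s n \<in> borel_measurable lborel" for n
      unfolding s_def by measurable
    show "AE x in lborel. norm (s n x) \<le> w x" for n
      using AE_lborel_singleton[of 0]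
    proof eventually_elim
      case (elim x)
      show ?case
      proof (cases "x > 0")
        case True
        have "\<bar>Im (f (Complex x (- 1 / real (Suc n))))\<bar> \<le> w x"
          using dom[of "Complex x (- 1 / real (Suc n))"] True abs_Im_le_cmod order.trans by fastforce
        moreover have "0 \<le> w x" using C by (simp add: w_def)
        ultimately show ?thesis by (auto simp: s_def indicator_def)
      next
        case False
        thus ?thesis using elim C by (simp add: s_def w_def)
      qed
    qed
    show "AE x in lborel. (\<lambda>n. s n x) \<longlonglongrightarrow> indicator {0<..} x * Im (f (of_real x))"
      using AE_lborel_singleton[of 0]
    proof eventually_elim
      case (elim x)
      show ?case
      proof (cases "x > 0")
        case True
        obtain N where N: "real N \<ge> x" using real_arch_simple by blast
        have "\<forall>\<^sub>F n in sequentially. Im (f (Complex x (- 1 / real (Suc n)))) = s n x"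
          using eventually_ge_at_top[of N]
        proof eventually_elim
          case (elim n)
          have "x \<le> real (Suc n)" using N elim by linarith
          thus ?case using True by (simp add: s_def)
        qed
        moreover have "(\<lambda>n. Im (f (Complex x (- 1 / real (Suc n))))) \<longlonglongrightarrow> Im (f (of_real x))"
          by (intro tendsto_Im lim True)
        ultimately show ?thesis using True by (simp add: Lim_transform_eventually)
      next
        case False
        thus ?thesis using elim by (simp add: s_def)
      qed
    qed
  qed auto
  with s0 have "(\<integral>x. indicator {0<..} x * Im (f (of_real x)) \<partial>lborel) = 0"
    using LIMSEQ_unique by blast
  thus "(LBINT t:{0<..}. Im (f (of_real t))) = 0"
    by (simp add: set_lebesgue_integral_def)
qed

section \<open>Weighted powers, binomial expansion and the final sum\<close>

lemma norm_weighted_bessel_product_le: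
  assumes n: "n > 0" and e: "real p - real n < e" "e < real p"
  obtains B where "\<And>z. z \<noteq> 0 \<Longrightarrow> norm (z ^ p * bessel_product z ^ n) \<le> B * norm z powr e"
proof -
  \<comment> \<open>The solution of p - 2 d n = e; the constraints on \<open>e\<close> say exactly
    that 0 < d < 1/2.\<close>
  define d where "d = (real p - e) / (2 * real n)"
  have d: "0 < d" "d < 1/2" using n e by (auto simp: d_def divide_simps)
  obtain B where B: "B \<ge> 0" "\<And>z. z \<noteq> 0 \<Longrightarrow> norm (bessel_product z) \<le> B * norm z powr (- 2 * d)"
    using norm_bessel_product_le[OF d] by blast
  have "norm (z ^ p * bessel_product z ^ n) \<le> B ^ n * norm z powr e" if z: "z \<noteq> 0" for z
  proof -
    have "norm (z ^ p * bessel_product z ^ n) = norm z ^ p * norm (bessel_product z) ^ n"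
      by (simp add: norm_mult norm_power)
    also have "\<dots> \<le> norm z ^ p * (B * norm z powr (- 2 * d)) ^ n"
      using B(2)[OF z] by (intro mult_left_mono power_mono) auto
    also have "\<dots> = B ^ n * (norm z powr real p * norm z powr (- 2 * d * real n))"
    proof -
      have "(norm z powr (- 2 * d)) ^ n = norm z powr (- 2 * d * real n)"
        using z by (subst powr_powr[symmetric], subst powr_realpow) auto
      thus ?thesis using z by (simp add: power_mult_distrib powr_realpow)
    qed
    also have "norm z powr real p * norm z powr (- 2 * d * real n) = norm z powr e"
    proof -
      have "real p + - 2 * d * real n = e" using n by (simp add: d_def field_simps)
      thus ?thesis by (simp flip: powr_add)
    qed
    finally show ?thesis .
  qed
  thus ?thesis by (rule that)
qed

lemma sum_pairs:
  fixes g :: "nat \<Rightarrow> 'a::comm_monoid_add"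
  shows "(\<Sum>k<2 * q. g k) = (\<Sum>m=1..q. g (2 * m - 2) + g (2 * m - 1))"
  by (induction q) (auto simp: algebra_simps)

text \<open>Only odd powers of i b have an imaginary contribution, and the imaginary part of i ^ (2
  m - 1) is - (- 1) ^ m.\<close>

lemma Im_binomial_power:
  fixes a b :: real
  shows "Im ((of_real a + \<i> * of_real b) ^ n) =
    (\<Sum>m=1..n div 2 + 1. - ((- 1) ^ m * real (n choose (2 * m - 1)) * a ^ (n - (2 * m - 1)) * b ^ (2 * m - 1)))"
proof -
  define g where "g = (\<lambda>k. of_nat (n choose k) * (\<i> * of_real b) ^ k * of_real a ^ (n - k) :: complex)"
  have "(of_real a + \<i> * of_real b) ^ n = (\<i> * of_real b + of_real a) ^ n" by (simp only: add.commute)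
  also have "\<dots> = (\<Sum>k\<le>n. g k)" by (simp add: binomial_ring g_def)
  \<comment> \<open>For odd \<open>n\<close> the two ranges agree; for even \<open>n\<close> the new
    index n + 1 has binomial coefficient 0.\<close>
  also have "\<dots> = (\<Sum>k<2 * (n div 2 + 1). g k)"
    by (rule sum.mono_neutral_left) (auto simp: g_def binomial_eq_0)
  also have "\<dots> = (\<Sum>m=1..n div 2 + 1. g (2 * m - 2) + g (2 * m - 1))"
    by (rule sum_pairs)
  finally have "Im ((of_real a + \<i> * of_real b) ^ n) = (\<Sum>m=1..n div 2 + 1. Im (g (2 * m - 2) + g (2 * m - 1)))"
    by simp
  also have "\<dots> = (\<Sum>m=1..n div 2 + 1. - ((- 1) ^ m * real (n choose (2 * m - 1)) * a ^ (n - (2 * m - 1)) * b ^ (2 * m - 1)))"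
  proof (rule sum.cong)
    fix m assume "m \<in> {1..n div 2 + 1}"
    then obtain j where m: "m = Suc j" by (cases m) auto
    have "\<i> ^ (2 * j) = of_real ((- 1) ^ j)" by (simp add: power_mult)
    hence g: "g (2 * j) = of_real (real (n choose (2 * j)) * (- 1) ^ j * b ^ (2 * j) * a ^ (n - 2 * j))"
      "g (Suc (2 * j)) = \<i> * of_real (real (n choose Suc (2 * j)) * (- 1) ^ j * b ^ Suc (2 * j) * a ^ (n - Suc (2 * j)))"
      by (simp_all add: g_def power_mult_distrib)
    have "2 * m - 2 = 2 * j" "2 * m - 1 = Suc (2 * j)" by (simp_all add: m)
    thus "Im (g (2 * m - 2) + g (2 * m - 1)) = - ((- 1) ^ m * real (n choose (2 * m - 1)) * a ^ (n - (2 * m - 1)) * b ^ (2 * m - 1))"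
      by (simp only: g plus_complex.sel Im_complex_of_real Im_i_times Re_complex_of_real) (simp add: m)
  qed simp
  finally show ?thesis .
qed

text \<open>The condition p + 2 < n makes -2 an admissible exponent in the power bound, and -1/2 is
  then admissible too. Oddness of n + p turns the sign (- 1) ^ (n + p) from the reflection into the
  minus that the half-line lemma requires.\<close>

lemma bessel_weighted_product_integral:
  fixes n p :: nat
  assumes p: "p + 2 < n" and odd: "odd (n + p)"
  defines "F \<equiv> (\<lambda>t. complex_of_real t ^ p * bessel_product (of_real t) ^ n)"
  shows "set_integrable lborel {0<..} (\<lambda>t. norm (F t))" and "(LBINT t:{0<..}. Im (F t)) = 0"
proof -
  define f where "f = (\<lambda>z. z ^ p * bessel_product z ^ n)"
  have exps: "n > 0" "real p - real n < - 2" "- 2 < real p" "real p - real n < - 1/2" "- 1/2 < real p"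
    using p by auto
  obtain B1 where B1: "\<And>z. z \<noteq> 0 \<Longrightarrow> norm (f z) \<le> B1 * norm z powr (- 2)"
    unfolding f_def by (rule norm_weighted_bessel_product_le[OF exps(1-3)]) blast
  obtain B2 where B2: "\<And>z. z \<noteq> 0 \<Longrightarrow> norm (f z) \<le> B2 * norm z powr (- 1/2)"
    unfolding f_def by (rule norm_weighted_bessel_product_le[OF exps(1,4,5)]) blast
  define C where "C = max B1 B2"
  have bound: "norm (f z) \<le> C * norm z powr (- 2)" "norm (f z) \<le> C * norm z powr (- 1/2)" if "z \<noteq> 0" for z
    using order.trans[OF B1[OF that] mult_right_mono[of B1 C]]
          order.trans[OF B2[OF that] mult_right_mono[of B2 C]]
    by (auto simp: C_def)
  have hol: "f holomorphic_on {z. Im z < 0}"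
    unfolding f_def by (intro holomorphic_intros bessel_product_holomorphic)
  have meas: "f \<in> borel_measurable borel" unfolding f_def by measurable
  have sym: "f (- cnj z) = - cnj (f z)" if "Im z < 0" for z
  proof -
    have "f (- cnj z) = (- cnj z) ^ p * (- cnj (bessel_product z)) ^ n"
      using that by (simp add: f_def bessel_product_reflect)
    also have "\<dots> = (- 1) ^ (n + p) * cnj (f z)"
      by (simp add: f_def power_minus[of "cnj z"] power_minus[of "cnj (bessel_product z)"] power_add)
    finally show ?thesis using odd by simp
  qed
  have lim: "(\<lambda>m. f (Complex t (- 1 / real (Suc m)))) \<longlonglongrightarrow> f (of_real t)" if t: "t > 0" for t
  proof -
    have z: "(\<lambda>m. 1 / real (Suc m)) \<longlonglongrightarrow> 0" by (rule lim_1_over_n[THEN LIMSEQ_Suc])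
    have "(\<lambda>m. bessel_product (Complex t (- (1 / real (Suc m))))) \<longlonglongrightarrow> bessel_product (of_real t)"
      by (rule bessel_product_boundary[OF t z]) simp
    moreover have "(\<lambda>m. Complex t (- (1 / real (Suc m)))) \<longlonglongrightarrow> Complex t (- 0)"
      by (intro tendsto_intros z)
    hence "(\<lambda>m. Complex t (- (1 / real (Suc m)))) \<longlonglongrightarrow> of_real t"
      by (simp add: complex_of_real_def)
    ultimately show ?thesis unfolding f_def by (simp add: tendsto_intros)
  qed
  note * = reflection_odd_half_line_integral[OF hol meas sym bound lim]
  show "set_integrable lborel {0<..} (\<lambda>t. norm (F t))" and "(LBINT t:{0<..}. Im (F t)) = 0"
    using * by (simp_all add: F_def f_def)
qed

theorem mainTheorem3:
  fixes n k :: nat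
  assumes "n - 1 \<ge> 2 * k" and "2 * k \<ge> 2"
  shows "(\<Sum>m = 1..n div 2 + 1. (- 1) ^ m * real (n choose (2 * m - 1)) *
           (LBINT t:{0<..}. (pi * bessel_I0 t) powi (int n - 2 * int m + 1)
              * bessel_K0 t ^ (n + 2 * m - 1) * t ^ (n - 2 * k - 1))) = 0"
proof -
  define p where "p = n - 2 * k - 1"
  \<comment> \<open>k >= 1 gives p <= n - 3, and n + p = 2 (n - k) - 1.\<close>
  have p: "p + 2 < n" "odd (n + p)" using assms by (auto simp: p_def)
  define F where "F = (\<lambda>t. complex_of_real t ^ p * bessel_product (of_real t) ^ n)"
  have F: "set_integrable lborel {0<..} (\<lambda>t. norm (F t))" "(LBINT t:{0<..}. Im (F t)) = 0"
    unfolding F_def by (rule bessel_weighted_product_integral[OF p])+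
  define h where "h = (\<lambda>m t. (pi * bessel_I0 t) ^ (n - (2 * m - 1)) * bessel_K0 t ^ (n + 2 * m - 1) * t ^ p)"
  \<comment> \<open>Writing I_0 and K_0 through the measurable function
    \<open>laplace_bessel\<close> supplies the measurability of the integrands.\<close>
  have I0: "pi * bessel_I0 t = - exp t * Im (laplace_bessel (of_real (- 2 * t)))"
    and K0: "bessel_K0 t = exp t * Re (laplace_bessel (of_real (- 2 * t)))" if "t > 0" for t
    unfolding laplace_bessel_neg[OF that] by (simp_all add: exp_minus power2_eq_square)
  have int: "set_integrable lborel {0<..} (h m)" if m: "m \<ge> 1" "2 * m - 1 \<le> n" for m
  proof (rule set_integrable_bound[OF F(1)])
    have "indicator {0<..} t *\<^sub>R h m t = indicator {0<..} t *\<^sub>R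
       ((- exp t * Im (laplace_bessel (of_real (- 2 * t)))) ^ (n - (2 * m - 1))
        * (exp t * Re (laplace_bessel (of_real (- 2 * t)))) ^ (n + 2 * m - 1) * t ^ p)" for t
    proof (cases "t > 0")
      case True
      show ?thesis unfolding h_def I0[OF True] K0[OF True] ..
    qed simp
    hence "(\<lambda>t. indicator {0<..} t *\<^sub>R h m t) = (\<lambda>t. indicator {0<..} t *\<^sub>R
       ((- exp t * Im (laplace_bessel (of_real (- 2 * t)))) ^ (n - (2 * m - 1))
        * (exp t * Re (laplace_bessel (of_real (- 2 * t)))) ^ (n + 2 * m - 1) * t ^ p))"
      by (rule ext)
    also have "\<dots> \<in> borel_measurable lborel" by measurable
    finally show "set_borel_measurable lborel {0<..} (h m)"
      unfolding set_borel_measurable_def .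
    \<comment> \<open>Since |a| and |b| are at most |a + i b|, each term |a|^(n - j) |b|^j is at
      most |a + i b|^n. Thus integrability of |F| gives that of every summand separately.\<close>
    have "\<bar>h m t\<bar> \<le> norm (F t)" if t: "t > 0" for t
    proof -
      define a b where "a = pi * bessel_I0 t" and "b = bessel_K0 t"
      have G: "bessel_product (of_real t) = of_real b * (of_real a + \<i> * of_real b)"
        using bessel_product_of_real[OF t] by (simp add: a_def b_def)
      have le: "\<bar>a\<bar> \<le> norm (of_real a + \<i> * of_real b)" "\<bar>b\<bar> \<le> norm (of_real a + \<i> * of_real b)"
        using abs_Re_le_cmod[of "of_real a + \<i> * of_real b"] abs_Im_le_cmod[of "of_real a + \<i> * of_real b"] by auto
      have "n + 2 * m - 1 = n + (2 * m - 1)" using m by simp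
      hence "\<bar>h m t\<bar> = t ^ p * \<bar>b\<bar> ^ n * (\<bar>a\<bar> ^ (n - (2 * m - 1)) * \<bar>b\<bar> ^ (2 * m - 1))"
        using t by (simp add: h_def a_def b_def abs_mult power_abs power_add)
      also have "\<dots> \<le> t ^ p * \<bar>b\<bar> ^ n * (norm (of_real a + \<i> * of_real b) ^ (n - (2 * m - 1))
          * norm (of_real a + \<i> * of_real b) ^ (2 * m - 1))"
        using t le by (intro mult_left_mono mult_mono power_mono) auto
      also have "\<dots> = t ^ p * \<bar>b\<bar> ^ n * norm (of_real a + \<i> * of_real b) ^ n"
        using m by (simp flip: power_add)
      also have "\<dots> = norm (F t)"
        using t by (simp add: F_def G norm_mult norm_power power_mult_distrib)
      finally show ?thesis .
    qed
    thus "AE t in lborel. t \<in> {0<..} \<longrightarrow> norm (h m t) \<le> norm (norm (F t))" by auto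
  qed
  have summand: "(- 1) ^ m * real (n choose (2 * m - 1)) *
           (LBINT t:{0<..}. (pi * bessel_I0 t) powi (int n - 2 * int m + 1)
              * bessel_K0 t ^ (n + 2 * m - 1) * t ^ (n - 2 * k - 1)) =
         (LBINT t:{0<..}. (- 1) ^ m * real (n choose (2 * m - 1)) * h m t)"
    and summand_int: "set_integrable lborel {0<..} (\<lambda>t. (- 1) ^ m * real (n choose (2 * m - 1)) * h m t)"
    if "m \<in> {1..n div 2 + 1}" for m
  proof -
    have m: "m \<ge> 1" using that by simp
    show "(- 1) ^ m * real (n choose (2 * m - 1)) *
           (LBINT t:{0<..}. (pi * bessel_I0 t) powi (int n - 2 * int m + 1)
              * bessel_K0 t ^ (n + 2 * m - 1) * t ^ (n - 2 * k - 1)) =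
         (LBINT t:{0<..}. (- 1) ^ m * real (n choose (2 * m - 1)) * h m t)"
    \<comment> \<open>The excluded case is the last index for even \<open>n\<close>: there the
      \<open>powi\<close> exponent is -1 whereas the truncated exponent in \<open>h\<close> is 0,
      and the vanishing binomial coefficient makes both sides 0.\<close>
    proof (cases "2 * m - 1 \<le> n")
      case True
      have "int n - 2 * int m + 1 = int (n - (2 * m - 1))" using True m by linarith
      hence "a powi (int n - 2 * int m + 1) = a ^ (n - (2 * m - 1))" for a :: real
        by (simp only: power_int_of_nat)
      thus ?thesis by (simp only: h_def p_def set_integral_mult_right)
    qed (simp add: binomial_eq_0)
    show "set_integrable lborel {0<..} (\<lambda>t. (- 1) ^ m * real (n choose (2 * m - 1)) * h m t)"
    proof (cases "2 * m - 1 \<le> n")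
      case True
      show ?thesis by (intro set_integrable_mult_right int m True)
    qed (simp add: binomial_eq_0 set_integrable_def)
  qed
  have "(\<Sum>m = 1..n div 2 + 1. (- 1) ^ m * real (n choose (2 * m - 1)) *
           (LBINT t:{0<..}. (pi * bessel_I0 t) powi (int n - 2 * int m + 1)
              * bessel_K0 t ^ (n + 2 * m - 1) * t ^ (n - 2 * k - 1))) =
        (\<Sum>m = 1..n div 2 + 1. LBINT t:{0<..}. (- 1) ^ m * real (n choose (2 * m - 1)) * h m t)"
    by (intro sum.cong summand) auto
  also have "\<dots> = (LBINT t:{0<..}. \<Sum>m = 1..n div 2 + 1. (- 1) ^ m * real (n choose (2 * m - 1)) * h m t)"
    using summand_int unfolding set_lebesgue_integral_def set_integrable_def scaleR_sum_right
    by (subst Bochner_Integration.integral_sum) auto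
  also have "\<dots> = (LBINT t:{0<..}. - Im (F t))"
  proof (rule set_lebesgue_integral_cong)
    show "\<forall>t. t \<in> {0<..} \<longrightarrow>
      (\<Sum>m = 1..n div 2 + 1. (- 1) ^ m * real (n choose (2 * m - 1)) * h m t) = - Im (F t)"
    proof (intro allI impI)
      fix t :: real assume "t \<in> {0<..}"
      hence t: "t > 0" by simp
      have "F t = of_real (t ^ p * bessel_K0 t ^ n) * (of_real (pi * bessel_I0 t) + \<i> * of_real (bessel_K0 t)) ^ n"
        unfolding F_def bessel_product_of_real[OF t] by (simp add: power_mult_distrib)
      hence "Im (F t) = (t ^ p * bessel_K0 t ^ n) * Im ((of_real (pi * bessel_I0 t) + \<i> * of_real (bessel_K0 t)) ^ n)"
        by (simp only: Im_complex_of_real Re_complex_of_real times_complex.sel)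
      also have "\<dots> = - (\<Sum>m = 1..n div 2 + 1. (- 1) ^ m * real (n choose (2 * m - 1)) * h m t)"
        unfolding Im_binomial_power sum_negf[symmetric] sum_distrib_left
      proof (rule sum.cong)
        fix m assume "m \<in> {1..n div 2 + 1}"
        hence "n + 2 * m - 1 = n + (2 * m - 1)" by simp
        thus "t ^ p * bessel_K0 t ^ n * - ((- 1) ^ m * real (n choose (2 * m - 1)) *
            (pi * bessel_I0 t) ^ (n - (2 * m - 1)) * bessel_K0 t ^ (2 * m - 1)) =
            - ((- 1) ^ m * real (n choose (2 * m - 1)) * h m t)"
          unfolding h_def by (simp only: power_add) (simp only: mult_ac mult_minus_right)
      qed simp
      finally show "(\<Sum>m = 1..n div 2 + 1. (- 1) ^ m * real (n choose (2 * m - 1)) * h m t) = - Im (F t)"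
        by simp
    qed
  qed simp
  also have "\<dots> = 0" using F(2) by (simp add: set_lebesgue_integral_def)
  finally show ?thesis .
qed

end
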